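(* For every complex number $a$ with $5a\notin\{0,-1,-2,\dots\}$, $$F_1\left(2a;\,a+\tfrac12,\,4a-1;\,5a;\,\tfrac{80}{81},\tfrac56\right)=\frac{3^{8a}}{2^{2a-1}5^{5a}}\,\frac{\pi\,\Gamma(5a)}{\Gamma(a+1/2)^2\,\Gamma(3a)}.$$
   Context: Appell's hypergeometric series is $F_1(\alpha;\beta_1,\beta_2;\gamma;x,y)=\sum_{m,n\ge0}\frac{(\alpha,m+n)(\beta_1,m)(\beta_2,n)}{(\gamma,m+n)(1,m)(1,n)}x^my^n$ for $\gamma\notin\{0,-1,-2,\dots\}$, absolutely convergent for $|x|<1$, $|y|<1$, where $(\alpha,n)=\alpha(\alpha+1)\cdots(\alpha+n-1)$, $(\alpha,0)=1$. For real $r>0$, $r^{a}=e^{a\log r}$ with real $\log r$. $1/\Gamma$ is the entire function (zero at the poles of $\Gamma$). *)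

theory Defs
  imports "HOL-Analysis.Analysis"
begin

text \<open>Unconditional summation over all pairs; for \<open>\<gamma>\<close> outside the non-positive integers and
  \<open>norm x < 1\<close>, \<open>norm y < 1\<close> the double series converges absolutely.  Outside that region the
  value need not be meaningful.\<close>
definition appell_F1 ::
  "complex \<Rightarrow> complex \<Rightarrow> complex \<Rightarrow> complex \<Rightarrow> complex \<Rightarrow> complex \<Rightarrow> complex" where
  "appell_F1 \<alpha> \<beta>\<^sub>1 \<beta>\<^sub>2 \<gamma> x y =
     (\<Sum>\<^sub>\<infinity>(m, n) \<in> (UNIV :: (nat \<times> nat) set).
        (pochhammer \<alpha> (m + n) * pochhammer \<beta>\<^sub>1 m * pochhammer \<beta>\<^sub>2 n) /
        (pochhammer \<gamma> (m + n) * pochhammer 1 m * pochhammer 1 n) * x ^ m * y ^ n)"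

end

theory Submission imports Defs "HOL-Complex_Analysis.Complex_Analysis" begin

text \<open>
  For real \<open>a > 1\<close> Euler's integral turns the left-hand side into
  \<open>1 / B(2a, 3a)\<close> times the integral over \<open>[0, 1]\<close> of
  \<open>w\<^sup>a (1 - yt) / (t (1 - t) (1 - xt)\<^sup>1\<^sup>/\<^sup>2)\<close>, where \<open>x = 80/81\<close>, \<open>y = 5/6\<close> and
  \<open>w = t\<^sup>2 (1 - t)\<^sup>3 / ((1 - xt) (1 - yt)\<^sup>4)\<close>. For these \<open>x\<close>, \<open>y\<close> the quintic
  \<open>(1 - xt) (1 - yt)\<^sup>4 - c t\<^sup>2 (1 - t)\<^sup>3\<close> with \<open>c = 5\<^sup>5/3\<^sup>8\<close> degenerates to the square of a quadratic \<open>P\<close>.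
  Hence \<open>u = P / ((1 - xt)\<^sup>1\<^sup>/\<^sup>2 (1 - yt)\<^sup>2)\<close> satisfies \<open>1 - u\<^sup>2 = c w\<close>, and \<open>v = (1 - u) / 2\<close> maps \<open>[0, 1]\<close>
  onto itself and reduces the integral to \<open>B(a, a)\<close>; the duplication formula gives the right-hand
  side. Both sides are holomorphic off the discrete set \<open>5a \<in> \<int>\<^sub>\<le>\<^sub>0\<close>, so the identity extends to all
  admissible \<open>a\<close>.
\<close>

section \<open>Uniform bounds and holomorphy of the Appell series in its parameters\<close>

text \<open>Consecutive quotients differ by the factor \<open>(p s + k) / (q s + k)\<close>, which
  tends to 1 uniformly on \<open>K\<close>, so from some index on each step costs at most a factor
  \<open>r\<close>. The finitely many earlier quotients are continuous, hence bounded on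
  \<open>K\<close>, and go into \<open>C\<close>.\<close>

lemma pochhammer_quotient_bound:
  fixes p q :: "'b :: topological_space \<Rightarrow> 'a :: real_normed_field"
  assumes "compact K" "continuous_on K p" "continuous_on K q"
    and q: "\<And>s. s \<in> K \<Longrightarrow> q s \<notin> \<int>\<^sub>\<le>\<^sub>0" and r: "r > 1"
  obtains C where "C > 0"
    "\<And>s k. s \<in> K \<Longrightarrow> norm (pochhammer (p s) k / pochhammer (q s) k) \<le> C * r ^ k"
proof -
  define f where "f k s = pochhammer (p s) k / pochhammer (q s) k" for k s
  have bounded_image: "\<exists>c. \<forall>s\<in>K. norm (h s) \<le> c" if "continuous_on K h" for h :: "'b \<Rightarrow> 'a"
    using compact_imp_bounded[OF compact_continuous_image[OF that \<open>compact K\<close>]]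
    by (auto simp: bounded_iff)
  obtain B1 B2 where B1: "\<And>s. s \<in> K \<Longrightarrow> norm (p s) \<le> B1"
    and B2: "\<And>s. s \<in> K \<Longrightarrow> norm (q s) \<le> B2"
    using bounded_image[of p] bounded_image[of q] assms by blast
  define B where "B = max 1 (max B1 B2)"
  have B: "norm (p s) \<le> B" "norm (q s) \<le> B" if "s \<in> K" for s
    using B1[OF that] B2[OF that] by (auto simp: B_def)
  have "B > 0" by (simp add: B_def)
  have "continuous_on K (f k)" for k
    unfolding f_def pochhammer_prod
    using assms q by (intro continuous_intros) (auto simp flip: pochhammer_prod dest: pochhammer_eq_0_imp_nonpos_Int)
  hence "\<exists>c. \<forall>s\<in>K. norm (f k s) \<le> c" for k
    by (rule bounded_image)
  then obtain c where c: "\<And>k s. s \<in> K \<Longrightarrow> norm (f k s) \<le> c k"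
    by metis
  \<comment> \<open>For \<open>k\<close> at least \<open>N\<close> the largest possible numerator
    \<open>B + k\<close> is at most \<open>r\<close> times the smallest possible denominator
    \<open>k - B\<close>; the threshold is this inequality solved for \<open>k\<close>.\<close>
  obtain N :: nat where N: "real N \<ge> B * (1 + r) / (r - 1)"
    using real_arch_simple by blast
  define C where "C = 1 + (\<Sum>k\<le>N. \<bar>c k\<bar>)"
  have "C > 0" unfolding C_def by (simp add: add_pos_nonneg sum_nonneg)
  have initial: "norm (f k s) \<le> C * r ^ k" if "k \<le> N" "s \<in> K" for k s
  proof -
    have "norm (f k s) \<le> \<bar>c k\<bar>"
      using c[OF \<open>s \<in> K\<close>, of k] by linarith
    also have "\<dots> \<le> (\<Sum>k\<le>N. \<bar>c k\<bar>)"
      by (rule member_le_sum) (use that in auto)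
    also have "\<dots> \<le> C * 1"
      by (simp add: C_def)
    also have "\<dots> \<le> C * r ^ k"
      using r \<open>C > 0\<close> by (intro mult_left_mono one_le_power) auto
    finally show ?thesis .
  qed
  have "norm (f k s) \<le> C * r ^ k" if "s \<in> K" for k s
  proof (induction k)
    case 0
    show ?case by (rule initial) (use that in auto)
  next
    case (Suc k)
    show ?case
    proof (cases "Suc k \<le> N")
      case True
      show ?thesis by (rule initial[OF True that])
    next
      case False
      have "B * (1 + r) / (r - 1) \<le> real k"
        using False N by linarith
      hence "B * (1 + r) \<le> real k * (r - 1)"
        using r by (simp add: pos_divide_le_eq)
      hence k: "B + real k \<le> r * (real k - B)"
        by (simp add: algebra_simps)
      have pos: "real k - B > 0"
      proof (rule ccontr)
        assume "\<not> real k - B > 0"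
        hence "r * (real k - B) \<le> 0"
          using r by (intro mult_nonneg_nonpos) auto
        with k \<open>B > 0\<close> show False by linarith
      qed
      have num: "norm (p s + of_nat k) \<le> B + real k"
        using norm_triangle_ineq[of "p s" "of_nat k"] B(1)[OF that] by simp
      have den: "real k - B \<le> norm (q s + of_nat k)"
        using norm_diff_ineq[of "of_nat k" "q s"] B(2)[OF that] by (simp add: add.commute)
      have "norm ((p s + of_nat k) / (q s + of_nat k)) \<le> (B + real k) / (real k - B)"
        unfolding norm_divide using num den pos \<open>B > 0\<close> by (intro frac_le) auto
      also have "\<dots> \<le> r"
        using k pos by (simp only: pos_divide_le_eq)
      finally have "norm (f k s) * norm ((p s + of_nat k) / (q s + of_nat k)) \<le> (C * r ^ k) * r"
        using Suc \<open>C > 0\<close> r by (intro mult_mono) auto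
      thus ?thesis
        by (simp add: f_def pochhammer_Suc norm_mult norm_divide mult_ac)
    qed
  qed
  with \<open>C > 0\<close> show ?thesis
    using that unfolding f_def by blast
qed

text \<open>Kept generic in the field so that one majorant serves both the complex parameters of the
  continuation and the real coefficients under Euler's integral.\<close>

definition appell_term ::
  "'a :: real_normed_field \<Rightarrow> 'a \<Rightarrow> 'a \<Rightarrow> 'a \<Rightarrow> 'a \<Rightarrow> 'a \<Rightarrow> nat \<times> nat \<Rightarrow> 'a" where
  "appell_term \<alpha> \<beta>\<^sub>1 \<beta>\<^sub>2 \<gamma> x y = (\<lambda>(m, n).
     (pochhammer \<alpha> (m + n) * pochhammer \<beta>\<^sub>1 m * pochhammer \<beta>\<^sub>2 n) /
     (pochhammer \<gamma> (m + n) * pochhammer 1 m * pochhammer 1 n) * x ^ m * y ^ n)"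

lemma appell_F1_eq_infsum: "appell_F1 \<alpha> \<beta>\<^sub>1 \<beta>\<^sub>2 \<gamma> x y = infsum (appell_term \<alpha> \<beta>\<^sub>1 \<beta>\<^sub>2 \<gamma> x y) UNIV"
  unfolding appell_F1_def appell_term_def by (rule refl)

text \<open>A term contains three Pochhammer quotients, of indices m + n, m and n, which together
  grow at most like r^(2m + 2n); a product of two geometric series dominates. Independence of
  \<open>s\<close> is what the Weierstrass M-test requires.\<close>

lemma appell_term_majorant:
  fixes \<alpha> \<beta>\<^sub>1 \<beta>\<^sub>2 \<gamma> :: "'b :: topological_space \<Rightarrow> 'a :: real_normed_field"
  assumes "compact K" "continuous_on K \<alpha>" "continuous_on K \<beta>\<^sub>1" "continuous_on K \<beta>\<^sub>2" "continuous_on K \<gamma>"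
    and "\<And>s. s \<in> K \<Longrightarrow> \<gamma> s \<notin> \<int>\<^sub>\<le>\<^sub>0" and xy: "norm x < 1" "norm y < 1"
  obtains M where "M summable_on UNIV"
    "\<And>s z. s \<in> K \<Longrightarrow> norm (appell_term (\<alpha> s) (\<beta>\<^sub>1 s) (\<beta>\<^sub>2 s) (\<gamma> s) x y z) \<le> M z"
proof -
  define w where "w = max (norm x) (norm y)"
  have w: "0 \<le> w" "w < 1" "norm x \<le> w" "norm y \<le> w"
    using xy by (auto simp: w_def le_max_iff_disj)
  \<comment> \<open>The exponential growth of the Pochhammer quotients costs a factor \<open>r\<^sup>2\<close> per variable;
    this \<open>r > 1\<close> still satisfies \<open>r\<^sup>2 w < 1\<close>.\<close>
  define r where "r = 2 / (1 + w)"
  have r: "r > 1" using w by (simp add: r_def field_simps)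
  have "0 < (1 - w)\<^sup>2" using w by simp
  hence "4 * w < (1 + w)\<^sup>2"
    by (simp add: power2_eq_square algebra_simps)
  hence "r\<^sup>2 * w < 1"
    using w by (simp add: r_def power_divide)
  moreover have "r\<^sup>2 * norm x \<le> r\<^sup>2 * w" "r\<^sup>2 * norm y \<le> r\<^sup>2 * w"
    using w by (auto intro!: mult_left_mono)
  ultimately have rxy: "r\<^sup>2 * norm x < 1" "r\<^sup>2 * norm y < 1" by auto
  note bound = pochhammer_quotient_bound[OF \<open>compact K\<close> _ _ _ r]
  have 1: "(1 :: 'a) \<notin> \<int>\<^sub>\<le>\<^sub>0" by simp
  obtain C0 where C0: "C0 > 0"
    "\<And>s k. s \<in> K \<Longrightarrow> norm (pochhammer (\<alpha> s) k / pochhammer (\<gamma> s) k) \<le> C0 * r ^ k"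
    using bound[of \<alpha> \<gamma>] assms by blast
  obtain C1 where C1: "C1 > 0"
    "\<And>s k. s \<in> K \<Longrightarrow> norm (pochhammer (\<beta>\<^sub>1 s) k / pochhammer 1 k) \<le> C1 * r ^ k"
    using bound[of \<beta>\<^sub>1 "\<lambda>_. 1"] assms 1 by (metis continuous_on_const)
  obtain C2 where C2: "C2 > 0"
    "\<And>s k. s \<in> K \<Longrightarrow> norm (pochhammer (\<beta>\<^sub>2 s) k / pochhammer 1 k) \<le> C2 * r ^ k"
    using bound[of \<beta>\<^sub>2 "\<lambda>_. 1"] assms 1 by (metis continuous_on_const)
  define G where "G = (\<lambda>(m, n). (r\<^sup>2 * norm x) ^ m * (r\<^sup>2 * norm y) ^ n)"
  define M where "M = (\<lambda>z. (C0 * C1 * C2) * G z)"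
  have geo: "((\<lambda>n. u ^ n) has_sum (1 / (1 - u))) UNIV" if "0 \<le> u" "u < 1" for u :: real
    using that geometric_sums[of u] by (intro sums_nonneg_imp_has_sum) auto
  have "G summable_on (UNIV \<times> UNIV)"
  proof (rule summable_on_SigmaI)
    show "((\<lambda>n. G (m, n)) has_sum ((r\<^sup>2 * norm x) ^ m * (1 / (1 - r\<^sup>2 * norm y)))) UNIV" for m
      unfolding G_def prod.case by (intro has_sum_cmult_right geo) (use rxy in auto)
    have "((\<lambda>m. (r\<^sup>2 * norm x) ^ m) has_sum (1 / (1 - r\<^sup>2 * norm x))) UNIV"
      using rxy by (intro geo) auto
    thus "(\<lambda>m. (r\<^sup>2 * norm x) ^ m * (1 / (1 - r\<^sup>2 * norm y))) summable_on UNIV"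
      using has_sum_cmult_left summable_on_def by blast
  qed (auto simp: G_def)
  hence "M summable_on UNIV"
    unfolding M_def by (intro summable_on_cmult_right) simp
  moreover have "norm (appell_term (\<alpha> s) (\<beta>\<^sub>1 s) (\<beta>\<^sub>2 s) (\<gamma> s) x y z) \<le> M z" if "s \<in> K" for s z
  proof (cases z)
    case (Pair m n)
    have "norm (appell_term (\<alpha> s) (\<beta>\<^sub>1 s) (\<beta>\<^sub>2 s) (\<gamma> s) x y z) =
      norm (pochhammer (\<alpha> s) (m + n) / pochhammer (\<gamma> s) (m + n)) *
      norm (pochhammer (\<beta>\<^sub>1 s) m / pochhammer 1 m) * norm (pochhammer (\<beta>\<^sub>2 s) n / pochhammer 1 n) *
      norm x ^ m * norm y ^ n"
      by (simp add: appell_term_def Pair norm_mult norm_divide norm_power)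
    also have "\<dots> \<le> (C0 * r ^ (m + n)) * (C1 * r ^ m) * (C2 * r ^ n) * norm x ^ m * norm y ^ n"
      using C0 C1 C2 r that by (intro mult_mono mult_nonneg_nonneg order.refl) auto
    also have "\<dots> = M z"
      by (simp add: M_def G_def Pair power_mult_distrib power_add power2_eq_square mult_ac)
    finally show ?thesis .
  qed
  ultimately show ?thesis using that by blast
qed

text \<open>On a small closed disc the finite partial sums converge uniformly by the M-test, so
  their limit is holomorphic in the interior.\<close>

lemma holomorphic_appell_F1:
  assumes "open S" "\<alpha> holomorphic_on S" "\<beta>\<^sub>1 holomorphic_on S" "\<beta>\<^sub>2 holomorphic_on S" "\<gamma> holomorphic_on S"
    and \<gamma>: "\<And>s. s \<in> S \<Longrightarrow> \<gamma> s \<notin> \<int>\<^sub>\<le>\<^sub>0" and "norm x < 1" "norm y < 1"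
  shows "(\<lambda>s. appell_F1 (\<alpha> s) (\<beta>\<^sub>1 s) (\<beta>\<^sub>2 s) (\<gamma> s) x y) holomorphic_on S"
proof -
  define f where "f z s = appell_term (\<alpha> s) (\<beta>\<^sub>1 s) (\<beta>\<^sub>2 s) (\<gamma> s) x y z" for z s
  have f_holo: "f z holomorphic_on S" for z
  proof -
    have "pochhammer (\<gamma> s) k \<noteq> 0" if "s \<in> S" for s k
      using \<gamma>[OF that] pochhammer_eq_0_imp_nonpos_Int by blast
    moreover have "pochhammer (1 :: complex) k \<noteq> 0" for k
      by (simp flip: pochhammer_fact)
    ultimately show ?thesis
      unfolding f_def appell_term_def case_prod_unfold
      by (intro holomorphic_on_mult holomorphic_on_divide holomorphic_pochhammer
          holomorphic_on_const assms(2-5)) simp_all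
  qed
  have "(\<lambda>s. appell_F1 (\<alpha> s) (\<beta>\<^sub>1 s) (\<beta>\<^sub>2 s) (\<gamma> s) x y) field_differentiable at z" if z: "z \<in> S" for z
  proof -
    obtain e where e: "e > 0" "cball z e \<subseteq> S"
      using \<open>open S\<close> z by (meson open_contains_cball_eq)
    have cont: "continuous_on (cball z e) h" if "h holomorphic_on S" for h
      by (rule continuous_on_subset[OF holomorphic_on_imp_continuous_on[OF that] e(2)])
    have \<gamma>': "\<gamma> s \<notin> \<int>\<^sub>\<le>\<^sub>0" if "s \<in> cball z e" for s
      using \<gamma> e(2) that by (meson subset_iff)
    obtain M where M: "M summable_on UNIV" "\<And>s z'. s \<in> cball z e \<Longrightarrow> norm (f z' s) \<le> M z'"
      by (rule appell_term_majorant[OF compact_cball[of z e] assms(2-5)[THEN cont] \<gamma>' assms(7,8)]) (assumption, rule that, assumption, simp add: f_def)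
    have lim: "uniform_limit (cball z e) (\<lambda>X s. \<Sum>z'\<in>X. f z' s) (\<lambda>s. \<Sum>\<^sub>\<infinity>z'. f z' s)
                (finite_subsets_at_top UNIV)"
      by (rule Weierstrass_m_test_general) (use M in auto)
    have "(\<lambda>s. \<Sum>\<^sub>\<infinity>z'. f z' s) holomorphic_on ball z e"
    proof (rule holomorphic_uniform_limit[OF _ lim])
      have holo: "(\<lambda>s. \<Sum>z'\<in>X. f z' s) holomorphic_on S" for X
        by (intro holomorphic_intros f_holo)
      have sub: "ball z e \<subseteq> S"
        using e(2) ball_subset_cball by (rule subset_trans[rotated])
      show "\<forall>\<^sub>F X in finite_subsets_at_top UNIV. continuous_on (cball z e) (\<lambda>s. \<Sum>z'\<in>X. f z' s) \<and>
             (\<lambda>s. \<Sum>z'\<in>X. f z' s) holomorphic_on ball z e"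
        by (intro always_eventually allI conjI cont[OF holo] holomorphic_on_subset[OF holo sub])
    qed auto
    thus ?thesis
      using e by (auto simp: f_def appell_F1_eq_infsum holomorphic_on_imp_differentiable_at)
  qed
  thus ?thesis
    by (auto simp: holomorphic_on_def intro: field_differentiable_at_within)
qed

section \<open>Binomial series and Euler's integral for real parameters\<close>

lemma binomial_series_has_sum:
  fixes z b :: real
  assumes "\<bar>z\<bar> < 1"
  shows "((\<lambda>n. pochhammer b n / fact n * z ^ n) has_sum (1 - z) powr (- b)) UNIV"
proof -
  have series: "(\<lambda>n. pochhammer b n / fact n * u ^ n) sums (1 - u) powr (- b)"
    if "\<bar>u\<bar> < 1" for u :: real
  proof -
    have "pochhammer b n / fact n * u ^ n = (- b gchoose n) * (- u) ^ n" for n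
      by (simp add: gbinomial_pochhammer power_minus[of u])
    thus ?thesis
      using gen_binomial_real[of "- u" "- b"] that by simp
  qed
  \<comment> \<open>Convergence at a point \<open>u\<close> beyond the absolute value of
    \<open>z\<close> gives absolute convergence at \<open>z\<close>, and hence the unconditional
    sum.\<close>
  obtain u where "\<bar>z\<bar> < u" "u < 1"
    using assms dense by blast
  hence "summable (\<lambda>n. norm (pochhammer b n / fact n * z ^ n))"
    using series[of u] by (intro powser_insidea[of _ u]) (auto simp: sums_iff)
  thus ?thesis
    using series[OF assms] by (rule norm_summable_imp_has_sum)
qed

text \<open>These are the moments of the Beta weight; with u = \<alpha> and u + v = \<gamma> they
  supply the quotient of Pochhammer symbols of index m + n in the Appell coefficients.\<close>

lemma Beta_add_nat:
  fixes u v :: real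
  assumes "u > 0" "v > 0"
  shows "Beta (u + of_nat k) v = Beta u v * pochhammer u k / pochhammer (u + v) k"
proof -
  have "u \<notin> \<int>\<^sub>\<le>\<^sub>0" "u + v \<notin> \<int>\<^sub>\<le>\<^sub>0"
    using assms by (auto dest: nonpos_Ints_nonpos)
  moreover have "Gamma u > 0" "Gamma (u + v) > 0"
    using assms by (auto intro: Gamma_real_pos)
  ultimately show ?thesis
    by (simp add: Beta_def pochhammer_Gamma add_ac)
qed

lemma appell_term_of_real:
  "appell_term (of_real \<alpha>) (of_real \<beta>\<^sub>1) (of_real \<beta>\<^sub>2) (of_real \<gamma>) (of_real x) (of_real y) z =
     of_real (appell_term \<alpha> \<beta>\<^sub>1 \<beta>\<^sub>2 \<gamma> x y z)"
  by (simp add: appell_term_def case_prod_unfold pochhammer_of_real pochhammer_fact[symmetric])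

text \<open>Both powers are expanded in binomial series and integrated term by term against the Beta
  weight. The exponents \<alpha> - 1 and \<gamma> - \<alpha> - 1 are positive, so the weight is
  continuous and at most 1 on the closed interval and the expansion converges uniformly.\<close>

lemma appell_F1_Euler_integral:
  fixes \<alpha> \<beta>\<^sub>1 \<beta>\<^sub>2 \<gamma> x y J :: real
  assumes "\<alpha> > 1" "\<gamma> - \<alpha> > 1" and xy: "\<bar>x\<bar> < 1" "\<bar>y\<bar> < 1"
    and J: "((\<lambda>t. t powr (\<alpha> - 1) * (1 - t) powr (\<gamma> - \<alpha> - 1) *
              ((1 - x * t) powr (- \<beta>\<^sub>1) * (1 - y * t) powr (- \<beta>\<^sub>2))) has_integral J) {0..1}"
  shows "appell_F1 (of_real \<alpha>) (of_real \<beta>\<^sub>1) (of_real \<beta>\<^sub>2) (of_real \<gamma>) (of_real x) (of_real y) =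
           of_real (J / Beta \<alpha> (\<gamma> - \<alpha>))"
proof -
  define w where "w t = t powr (\<alpha> - 1) * (1 - t) powr (\<gamma> - \<alpha> - 1)" for t
  \<comment> \<open>With \<alpha> and \<gamma> both set to 1 the quotient of index m + n cancels,
    leaving the coefficients of the product of the two binomial series.\<close>
  define c where "c = appell_term 1 \<beta>\<^sub>1 \<beta>\<^sub>2 1 x y"
  define h where "h = (\<lambda>z t. w t * (c z * t ^ (fst z + snd z)))"
  define G where "G t = w t * ((1 - x * t) powr (- \<beta>\<^sub>1) * (1 - y * t) powr (- \<beta>\<^sub>2))" for t
  have "\<exists>M. M summable_on UNIV \<and> (\<forall>z. norm (c z) \<le> M z)"
    by (rule appell_term_majorant[of "{0 :: real}" "\<lambda>_. 1" "\<lambda>_. \<beta>\<^sub>1" "\<lambda>_. \<beta>\<^sub>2" "\<lambda>_. 1" x y])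
       (use xy in \<open>auto simp: c_def\<close>)
  then obtain M where M: "M summable_on UNIV" "\<And>z. norm (c z) \<le> M z"
    by blast
  have h_le: "norm (h z t) \<le> M z" if "t \<in> {0..1}" for z t
  proof -
    have "norm (w t) \<le> 1 * 1"
      unfolding w_def norm_mult using that assms by (intro mult_mono) (auto intro!: powr_le1)
    moreover have "norm (t ^ (fst z + snd z)) \<le> 1"
      using that by (auto simp: norm_power intro!: power_le_one)
    ultimately have "norm (h z t) \<le> 1 * (norm (c z) * 1)"
      unfolding h_def norm_mult by (intro mult_mono) auto
    with M(2)[of z] show ?thesis by simp
  qed
  have h_sum: "((\<lambda>z. h z t) has_sum G t) UNIV" if t: "t \<in> {0..1}" for t
  proof -
    have "\<bar>x * t\<bar> < 1" "\<bar>y * t\<bar> < 1"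
      using xy t mult_le_cancel_left1[of "\<bar>x\<bar>" t] mult_le_cancel_left1[of "\<bar>y\<bar>" t]
      by (auto simp: abs_mult intro: le_less_trans[OF mult_left_le])
    note b = binomial_series_has_sum[OF this(1), of \<beta>\<^sub>1] binomial_series_has_sum[OF this(2), of \<beta>\<^sub>2]
    have split: "h (m, n) t = w t * ((pochhammer \<beta>\<^sub>1 m / fact m * (x * t) ^ m) *
        (pochhammer \<beta>\<^sub>2 n / fact n * (y * t) ^ n))" for m n
    proof -
      have "pochhammer (1 :: real) k \<noteq> 0" for k
        by (simp flip: pochhammer_fact)
      thus ?thesis
        by (simp add: h_def c_def appell_term_def pochhammer_fact power_mult_distrib power_add)
    qed
    have "((\<lambda>z. h z t) has_sum G t) (UNIV \<times> UNIV)"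
    proof (rule has_sum_SigmaI)
      show "((\<lambda>n. h (m, n) t) has_sum
        (w t * ((pochhammer \<beta>\<^sub>1 m / fact m * (x * t) ^ m) * (1 - y * t) powr (- \<beta>\<^sub>2)))) UNIV" for m
        unfolding split by (intro has_sum_cmult_right b)
      show "((\<lambda>m. w t * ((pochhammer \<beta>\<^sub>1 m / fact m * (x * t) ^ m) * (1 - y * t) powr (- \<beta>\<^sub>2))) has_sum G t) UNIV"
        unfolding G_def by (intro has_sum_cmult_right has_sum_cmult_left b)
      have "(\<lambda>z. norm (h z t)) summable_on UNIV"
        by (rule Infinite_Sum.abs_summable_on_comparison_test'[OF M(1)]) (use h_le t in auto)
      thus "(\<lambda>z. h z t) summable_on (UNIV \<times> UNIV)"
        by (simp add: abs_summable_summable)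
    qed
    thus ?thesis by simp
  qed
  have lim: "uniform_limit {0..1} (\<lambda>X t. \<Sum>z\<in>X. h z t) G (finite_subsets_at_top UNIV)"
    by (rule Weierstrass_m_test_general'[OF _ _ M(1)]) (use h_le h_sum in auto)
  have "continuous_on {0..1} w"
    unfolding w_def using assms by (intro continuous_intros continuous_on_powr') auto
  hence cont: "continuous_on {0..1} (\<lambda>t. \<Sum>z\<in>X. h z t)" for X
    unfolding h_def by (intro continuous_intros)
  \<comment> \<open>Uniform convergence along finite sets of index pairs passes to the integrals in
    the same filter, which is convergence in the sense of \<open>has_sum\<close>.\<close>
  obtain I J' where I: "\<And>X. ((\<lambda>t. \<Sum>z\<in>X. h z t) has_integral I X) {0..1}"
    and J': "(G has_integral J') {0..1}" and IJ: "(I \<longlongrightarrow> J') (finite_subsets_at_top UNIV)"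
    using uniform_limit_integral[OF lim cont] by auto
  have "J' = J"
    using J' J unfolding G_def w_def by (rule has_integral_unique)
  have "I X = (\<Sum>z\<in>X. Beta \<alpha> (\<gamma> - \<alpha>) * appell_term \<alpha> \<beta>\<^sub>1 \<beta>\<^sub>2 \<gamma> x y z)" for X
  proof (rule has_integral_unique[OF I])
    have "(h z has_integral Beta \<alpha> (\<gamma> - \<alpha>) * appell_term \<alpha> \<beta>\<^sub>1 \<beta>\<^sub>2 \<gamma> x y z) {0..1}" for z
    proof -
      define k where "k = fst z + snd z"
      have "((\<lambda>t. c z * (t powr (\<alpha> + real k - 1) * (1 - t) powr (\<gamma> - \<alpha> - 1))) has_integral
        (c z * Beta (\<alpha> + real k) (\<gamma> - \<alpha>))) {0..1}"
        using assms by (intro has_integral_mult_right has_integral_Beta_real) auto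
      moreover have "c z * (t powr (\<alpha> + real k - 1) * (1 - t) powr (\<gamma> - \<alpha> - 1)) = h z t"
        if "t \<in> {0..1}" for t
      proof (cases "t = 0")
        \<comment> \<open>Both sides vanish at 0, because \<open>0 powr p\<close> is 0 for every
          \<open>p\<close>.\<close>
        case True
        thus ?thesis using assms by (simp add: h_def w_def)
      next
        case False
        hence "t powr (\<alpha> + real k - 1) = t powr (\<alpha> - 1) * t ^ k"
          using that by (simp add: powr_realpow[symmetric] flip: powr_add) (simp add: algebra_simps)
        thus ?thesis by (simp add: h_def w_def k_def)
      qed
      moreover have "c z * Beta (\<alpha> + real k) (\<gamma> - \<alpha>) =
          Beta \<alpha> (\<gamma> - \<alpha>) * appell_term \<alpha> \<beta>\<^sub>1 \<beta>\<^sub>2 \<gamma> x y z"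
      proof -
        have "pochhammer (1 :: real) n \<noteq> 0" for n
          by (simp flip: pochhammer_fact)
        thus ?thesis
          using assms Beta_add_nat[of \<alpha> "\<gamma> - \<alpha>" k]
          by (simp add: c_def k_def appell_term_def case_prod_unfold mult_ac)
      qed
      ultimately show ?thesis
        by (metis (no_types, lifting) has_integral_cong)
    qed
    thus "((\<lambda>t. \<Sum>z\<in>X. h z t) has_integral
      (\<Sum>z\<in>X. Beta \<alpha> (\<gamma> - \<alpha>) * appell_term \<alpha> \<beta>\<^sub>1 \<beta>\<^sub>2 \<gamma> x y z)) {0..1}"
      \<comment> \<open>For infinite \<open>X\<close> both sums are 0 by convention.\<close>
      by (cases "finite X") (auto intro: has_integral_sum)
  qed
  hence "I = sum (\<lambda>z. Beta \<alpha> (\<gamma> - \<alpha>) * appell_term \<alpha> \<beta>\<^sub>1 \<beta>\<^sub>2 \<gamma> x y z)"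
    by (rule ext)
  hence "((\<lambda>z. Beta \<alpha> (\<gamma> - \<alpha>) * appell_term \<alpha> \<beta>\<^sub>1 \<beta>\<^sub>2 \<gamma> x y z) has_sum J) UNIV"
    using IJ \<open>J' = J\<close> by (simp add: has_sum_def)
  hence "((\<lambda>z. inverse (Beta \<alpha> (\<gamma> - \<alpha>)) * (Beta \<alpha> (\<gamma> - \<alpha>) * appell_term \<alpha> \<beta>\<^sub>1 \<beta>\<^sub>2 \<gamma> x y z))
          has_sum (inverse (Beta \<alpha> (\<gamma> - \<alpha>)) * J)) UNIV"
    by (rule has_sum_cmult_right)
  moreover have "Gamma \<alpha> > 0" "Gamma (\<gamma> - \<alpha>) > 0" "Gamma \<gamma> > 0"
    using assms by (auto intro: Gamma_real_pos)
  hence "Beta \<alpha> (\<gamma> - \<alpha>) \<noteq> 0"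
    by (simp add: Beta_def)
  ultimately have "(appell_term \<alpha> \<beta>\<^sub>1 \<beta>\<^sub>2 \<gamma> x y has_sum (J / Beta \<alpha> (\<gamma> - \<alpha>))) UNIV"
    by (simp add: field_simps)
  hence "((\<lambda>z. of_real (appell_term \<alpha> \<beta>\<^sub>1 \<beta>\<^sub>2 \<gamma> x y z) :: complex) has_sum of_real (J / Beta \<alpha> (\<gamma> - \<alpha>))) UNIV"
    by (rule has_sum_of_real)
  thus ?thesis
    unfolding appell_F1_eq_infsum appell_term_of_real[symmetric] by (rule infsumI)
qed

section \<open>Reduction of the Euler integral to B(a, a)\<close>

text \<open>Substituting s = v(t) in the integral for B(a, a) yields this integrand up to a
  constant. With c = 3125/6561, the power of v (1 - v) contributes (c/4)^(a - 1) and the derivative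
  of v contributes c/2; the prefactor cancels both.\<close>

lemma quintic_substitution_integral:
  fixes a :: real
  assumes "a > 1"
  shows "((\<lambda>t. t powr (2 * a - 1) * (1 - t) powr (3 * a - 1) *
            ((1 - 80 / 81 * t) powr (- (a + 1 / 2)) * (1 - 5 / 6 * t) powr (- (4 * a - 1)))) has_integral
          2 * 4 powr (a - 1) * (6561 / 3125) powr a * Beta a a) {0..1}"
proof -
  define X where "X t = 1 - 80 / 81 * t" for t :: real
  define Y where "Y t = 1 - 5 / 6 * t" for t :: real
  \<comment> \<open>\<open>P\<close> agrees with \<open>sqrt (X t) * Y t ^ 2\<close> to first order
    at 0, and its value -1/324 at 1 is the negative of that expression; so \<open>v\<close> goes
    from 0 to 1.\<close>
  define P where "P t = 1 - 175 / 81 * t + 125 / 108 * t\<^sup>2" for t :: real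
  define v where "v t = (1 - P t / (sqrt (X t) * Y t ^ 2)) / 2" for t
  \<comment> \<open>This is the derivative of \<open>v\<close>: the double zero of v (1 - v) at 0
    and the triple zero at 1 leave t (1 - t)^2, and the remaining quadratic cancels against the
    numerator \<open>P\<close> of 1 - 2v.\<close>
  define v' where "v' t = 3125 / 6561 * t * (1 - t)\<^sup>2 / (2 * X t * sqrt (X t) * Y t ^ 3)" for t
  define f where "f s = s powr (a - 1) * (1 - s) powr (a - 1)" for s :: real
  have pos: "X t > 0" "Y t > 0" if "t \<in> {0..1}" for t
    using that by (auto simp: X_def Y_def)
  have v_quad: "v t * (1 - v t) = 3125 / 6561 * t\<^sup>2 * (1 - t) ^ 3 / (4 * X t * Y t ^ 4)"
    if t: "t \<in> {0..1}" for t
  proof -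
    \<comment> \<open>The terms in t^5 cancel, since (80/81) (5/6)^4 = 3125/6561, and the quartic
      that remains is a perfect square.\<close>
    have "(P t)\<^sup>2 = X t * Y t ^ 4 - 3125 / 6561 * t\<^sup>2 * (1 - t) ^ 3"
      unfolding P_def X_def Y_def by algebra
    moreover have "v t * (1 - v t) = (1 - (P t)\<^sup>2 / (X t * Y t ^ 4)) / 4"
      using pos[OF t] by (simp add: v_def field_simps power2_eq_square eval_nat_numeral)
    ultimately show ?thesis
      using pos[OF t] by (simp add: field_simps)
  qed
  have v_range: "v t \<in> {0..1}" if t: "t \<in> {0..1}" for t
  proof -
    \<comment> \<open>The sign of the product alone confines \<open>v\<close> to [0, 1], with no
      appeal to monotonicity.\<close>
    have "v t * (1 - v t) \<ge> 0"
      unfolding v_quad[OF t] using pos[OF t] t by (intro divide_nonneg_pos mult_nonneg_nonneg) auto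
    thus ?thesis by (auto simp: zero_le_mult_iff)
  qed
  have v_deriv: "(v has_field_derivative v' t) (at t within {0..1})" if t: "t \<in> {0..1}" for t
  proof -
    \<comment> \<open>Writing \<open>X t\<close> as \<open>r * r\<close> makes the expression from
      the quotient rule rational, so that denominators can be cleared.\<close>
    define r where "r = sqrt (X t)"
    have r: "r > 0" "r * r = X t" using pos[OF t] by (auto simp: r_def)
    have dX: "((\<lambda>t. sqrt (X t)) has_field_derivative (- (40 / 81) / r)) (at t within {0..1})"
      unfolding X_def[abs_def] r_def using pos[OF t]
      by (auto intro!: derivative_eq_intros simp: X_def field_simps)
    have dY: "((\<lambda>t. Y t ^ 2) has_field_derivative (- (5 / 3) * Y t)) (at t within {0..1})"
      unfolding Y_def[abs_def] by (auto intro!: derivative_eq_intros)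
    have dP: "(P has_field_derivative (- 175 / 81 + 125 / 54 * t)) (at t within {0..1})"
      unfolding P_def[abs_def] by (auto intro!: derivative_eq_intros)
    have "(v has_field_derivative
        (0 - ((- 175 / 81 + 125 / 54 * t) * (sqrt (X t) * Y t ^ 2) -
            P t * (- (40 / 81) / r * Y t ^ 2 + - (5 / 3) * Y t * sqrt (X t))) /
            (sqrt (X t) * Y t ^ 2 * (sqrt (X t) * Y t ^ 2))) / 2)
        (at t within {0..1})"
      unfolding v_def[abs_def] using pos[OF t]
      by (intro DERIV_cdivide DERIV_diff DERIV_const DERIV_divide DERIV_mult dX dY dP) simp
    also have "(0 - ((- 175 / 81 + 125 / 54 * t) * (sqrt (X t) * Y t ^ 2) -
            P t * (- (40 / 81) / r * Y t ^ 2 + - (5 / 3) * Y t * sqrt (X t))) /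
            (sqrt (X t) * Y t ^ 2 * (sqrt (X t) * Y t ^ 2))) / 2
         = - ((- 175 / 81 + 125 / 54 * t) * X t * Y t + P t * (40 / 81 * Y t + 5 / 3 * X t))
            / (2 * X t * r * Y t ^ 3)"
      using pos[OF t] r(1) unfolding r(2)[symmetric] r_def[symmetric]
      by (simp add: divide_simps eval_nat_numeral) (simp add: algebra_simps)
    also have "- ((- 175 / 81 + 125 / 54 * t) * X t * Y t + P t * (40 / 81 * Y t + 5 / 3 * X t))
         = 3125 / 6561 * t * (1 - t)\<^sup>2"
      unfolding P_def X_def Y_def by algebra
    finally show ?thesis
      by (simp add: v'_def r_def)
  qed
  have "continuous_on {0..1} f"
    unfolding f_def using assms by (intro continuous_intros continuous_on_powr') auto
  moreover have ends: "v 0 = 0" "v 1 = 1"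
  proof -
    have "sqrt (1 / 81 :: real) = 1 / 9"
      by (rule real_sqrt_unique) (auto simp: power2_eq_square)
    thus "v 0 = 0" "v 1 = 1"
      by (simp_all add: v_def P_def X_def Y_def power2_eq_square)
  qed
  ultimately have "((\<lambda>t. v' t *\<^sub>R f (v t)) has_integral (integral {v 0..v 1} f)) {0..1}"
    by (intro has_integral_substitution[where c = 0 and d = 1] v_deriv)
       (use v_range in auto)
  moreover have "integral {0..1} f = Beta a a"
    unfolding f_def using assms by (intro integral_unique has_integral_Beta_real) auto
  ultimately have "((\<lambda>t. v' t * f (v t)) has_integral Beta a a) {0..1}"
    by (simp add: ends)
  hence "((\<lambda>t. 2 * 4 powr (a - 1) * (6561 / 3125) powr a * (v' t * f (v t))) has_integral
     2 * 4 powr (a - 1) * (6561 / 3125) powr a * Beta a a) {0..1}"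
    by (rule has_integral_mult_right)
  moreover have "2 * 4 powr (a - 1) * (6561 / 3125) powr a * (v' t * f (v t)) =
     t powr (2 * a - 1) * (1 - t) powr (3 * a - 1) * (X t powr (- (a + 1 / 2)) * Y t powr (- (4 * a - 1)))"
    if t: "t \<in> {0..1}" for t
  proof (cases "t = 0 \<or> t = 1")
    \<comment> \<open>At both ends \<open>v\<close> is 0 or 1 and each side has a factor
      \<open>0 powr p\<close>, which is 0; the logarithms used below exist only inside the
      interval.\<close>
    case True
    thus ?thesis using assms ends by (auto simp: f_def)
  next
    case False
    hence t': "0 < t" "t < 1" using t by auto
    have "f (v t) = (v t * (1 - v t)) powr (a - 1)"
      using v_range[OF t] by (simp add: f_def powr_mult)
    also have "\<dots> = (3125 / 6561 * t\<^sup>2 * (1 - t) ^ 3 / (4 * X t * Y t ^ 4)) powr (a - 1)"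
      by (simp only: v_quad[OF t])
    finally have f: "f (v t) = \<dots>" .
    \<comment> \<open>In logarithmic coordinates each factor is the exponential of a linear form, up
      to a factor 2, and the identity reduces to comparing exponents.\<close>
    define T U R S k l where "T = ln t" "U = ln (1 - t)" "R = ln (X t)" "S = ln (Y t)"
      "k = ln (6561 / 3125 :: real)" "l = ln (4 :: real)"
    note logs = this
    have exps: "exp T = t" "exp U = 1 - t" "exp R = X t" "exp S = Y t" "exp (- k) = 3125 / 6561"
      "exp (R / 2) = sqrt (X t)"
      using t' pos[OF t] by (simp_all add: logs exp_minus ln_sqrt[symmetric])
    have "ln (3125 / 6561 * t\<^sup>2 * (1 - t) ^ 3 / (4 * X t * Y t ^ 4)) =
        - k + 2 * T + 3 * U - l - R - 4 * S"
      using t' pos[OF t] ln_mult[of "6561 :: real" 4] by (simp add: logs ln_mult ln_div ln_realpow)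
    hence "f (v t) = exp ((a - 1) * (- k + 2 * T + 3 * U - l - R - 4 * S))"
      using t' pos[OF t] unfolding f by (simp add: powr_def)
    \<comment> \<open>The multiples of \<open>U\<close> and \<open>S\<close> are spelled as repeated
      sums so that \<open>exp_add\<close> splits them into single factors.\<close>
    moreover have "v' t = exp (- k + T + (U + U) - R - R / 2 - (S + S + S)) / 2"
      unfolding exp_add exp_diff exps by (simp add: v'_def power2_eq_square power3_eq_cube)
    moreover have "4 powr (a - 1) = exp ((a - 1) * l)" "(6561 / 3125) powr a = exp (a * k)"
      "t powr (2 * a - 1) = exp ((2 * a - 1) * T)" "(1 - t) powr (3 * a - 1) = exp ((3 * a - 1) * U)"
      "X t powr (- (a + 1 / 2)) = exp (- (a + 1 / 2) * R)" "Y t powr (- (4 * a - 1)) = exp (- (4 * a - 1) * S)"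
      using t' pos[OF t] by (simp_all add: powr_def logs)
    moreover have "2 * exp ((a - 1) * l) * exp (a * k) *
        (exp (- k + T + (U + U) - R - R / 2 - (S + S + S)) / 2 *
         exp ((a - 1) * (- k + 2 * T + 3 * U - l - R - 4 * S))) =
        exp ((2 * a - 1) * T) * exp ((3 * a - 1) * U) *
        (exp (- (a + 1 / 2) * R) * exp (- (4 * a - 1) * S))"
      by (simp flip: exp_add) (simp add: field_simps)
    ultimately show ?thesis
      by (simp only:)
  qed
  ultimately show ?thesis
    unfolding X_def Y_def by (metis (no_types, lifting) has_integral_cong)
qed

section \<open>Gamma evaluation for real a > 1\<close>

text \<open>B(a, a) / B(2a, 3a) is (Gamma(a) / Gamma(2a))^2 Gamma(5a) / Gamma(3a), and the
  duplication formula turns the squared quotient into pi / (2^(2a - 1) Gamma(a + 1/2))^2.\<close>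

lemma appell_F1_special_value_real:
  fixes a :: real
  assumes "a > 1"
  shows "appell_F1 (of_real (2 * a)) (of_real (a + 1 / 2)) (of_real (4 * a - 1)) (of_real (5 * a))
           (of_real (80 / 81)) (of_real (5 / 6)) =
         of_real (3 powr (8 * a) / (2 powr (2 * a - 1) * 5 powr (5 * a)) *
           (pi * Gamma (5 * a) * rGamma (a + 1 / 2) ^ 2 * rGamma (3 * a)))"
proof -
  have pos: "Gamma a > 0" "Gamma (2 * a) > 0" "Gamma (3 * a) > 0" "Gamma (5 * a) > 0" "Gamma (a + 1 / 2) > 0"
    using assms by (auto intro: Gamma_real_pos)
  have "complex_of_real a \<notin> \<int>\<^sub>\<le>\<^sub>0" "complex_of_real (a + 1 / 2) \<notin> \<int>\<^sub>\<le>\<^sub>0"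
    using assms by (auto simp: complex_is_Int_iff complex_eq_iff elim!: nonpos_Ints_cases)
  hence "Gamma (complex_of_real a) * Gamma (complex_of_real (a + 1 / 2)) =
      exp ((1 - 2 * complex_of_real a) * of_real (ln 2)) * of_real (sqrt pi) * Gamma (2 * complex_of_real a)"
    using Gamma_legendre_duplication[of "complex_of_real a"] by simp
  hence "complex_of_real (Gamma a * Gamma (a + 1 / 2)) =
      complex_of_real (exp ((1 - 2 * a) * ln 2) * sqrt pi * Gamma (2 * a))"
    by (simp flip: Gamma_complex_of_real exp_of_real)
  hence dup: "Gamma a * Gamma (a + 1 / 2) = 2 powr (1 - 2 * a) * sqrt pi * Gamma (2 * a)"
    unfolding of_real_eq_iff by (simp add: powr_def)
  have pows: "4 powr (a - 1) = 2 powr (2 * a - 1) / 2" "2 powr (1 - 2 * a) = 1 / 2 powr (2 * a - 1)"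
    "(6561 / 3125) powr a = 3 powr (8 * a) / 5 powr (5 * a)"
  proof -
    have "(4 :: real) powr (a - 1) = 2 powr ((2 * a - 1) - 1)"
      using powr_powr[of "2 :: real" 2 "a - 1"] by (simp add: algebra_simps)
    thus "4 powr (a - 1) = 2 powr (2 * a - 1) / 2"
      by (subst (asm) powr_diff) simp
    show "2 powr (1 - 2 * a) = 1 / 2 powr (2 * a - 1)"
      by (simp add: powr_diff)
    have "(6561 :: real) = 3 powr 8" "(3125 :: real) = 5 powr 5" by simp_all
    thus "(6561 / 3125) powr a = 3 powr (8 * a) / 5 powr (5 * a)"
      by (simp only: powr_powr powr_divide powr_ge_zero)
  qed
  \<comment> \<open>The prefactor \<open>2 * 4 powr (a - 1)\<close> equals \<open>D\<close>, while
    the squared duplication formula contributes \<open>D\<close> to the power -2; one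
    \<open>D\<close> stays in the denominator.\<close>
  define D where "D = (2 :: real) powr (2 * a - 1)"
  have "D > 0" by (simp add: D_def)
  have "Gamma a / Gamma (2 * a) = sqrt pi / (D * Gamma (a + 1 / 2))"
    using dup pos \<open>D > 0\<close> unfolding pows D_def[symmetric] by (simp add: field_simps)
  hence "(Gamma a / Gamma (2 * a))\<^sup>2 = pi / (D\<^sup>2 * Gamma (a + 1 / 2) ^ 2)"
    by (simp add: power_divide power_mult_distrib)
  hence sq: "Gamma a * Gamma a = pi * (Gamma (2 * a))\<^sup>2 / (D\<^sup>2 * Gamma (a + 1 / 2) ^ 2)"
    using pos by (simp add: power_divide power2_eq_square field_simps)
  have "2 * 4 powr (a - 1) * (6561 / 3125) powr a * Beta a a / Beta (2 * a) (3 * a) =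
        3 powr (8 * a) / (D * 5 powr (5 * a)) *
          (pi * Gamma (5 * a) * rGamma (a + 1 / 2) ^ 2 * rGamma (3 * a))"
    unfolding pows D_def[symmetric] Beta_def rGamma_inverse_Gamma sq
    using pos \<open>D > 0\<close> by (simp add: divide_simps power2_eq_square)
  moreover have "appell_F1 (of_real (2 * a)) (of_real (a + 1 / 2)) (of_real (4 * a - 1)) (of_real (5 * a))
           (of_real (80 / 81)) (of_real (5 / 6)) =
     of_real (2 * 4 powr (a - 1) * (6561 / 3125) powr a * Beta a a / Beta (2 * a) (5 * a - 2 * a))"
    using assms quintic_substitution_integral[OF assms]
    by (intro appell_F1_Euler_integral) simp_all
  ultimately show ?thesis
    by (simp add: D_def)
qed

section \<open>Analytic continuation to complex a\<close>

text \<open>At admissible points such as a = -1/2 or a = -1/3 a Gamma function in the denominator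
  has a pole; the entire function \<open>rGamma\<close> makes the right-hand side zero
  there.\<close>

theorem mainTheorem6:
  fixes a :: complex
  assumes "5 * a \<notin> \<int>\<^sub>\<le>\<^sub>0"
  shows "appell_F1 (2 * a) (a + 1 / 2) (4 * a - 1) (5 * a) (80 / 81) (5 / 6) =
           3 powr (8 * a) / (2 powr (2 * a - 1) * 5 powr (5 * a)) *
           (complex_of_real pi * Gamma (5 * a) * rGamma (a + 1 / 2) ^ 2 * rGamma (3 * a))"
proof -
  define S where "S = {a :: complex. 5 * a \<notin> \<int>\<^sub>\<le>\<^sub>0}"
  define F where "F a = appell_F1 (2 * a) (a + 1 / 2) (4 * a - 1) (5 * a) (80 / 81) (5 / 6)" for a
  define R where "R a = 3 powr (8 * a) / (2 powr (2 * a - 1) * 5 powr (5 * a)) *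
           (complex_of_real pi * Gamma (5 * a) * rGamma (a + 1 / 2) ^ 2 * rGamma (3 * a))" for a :: complex
  define U where "U = complex_of_real ` {1<..}"
  have S_eq: "S = - ((*) 5 -` \<int>\<^sub>\<le>\<^sub>0)" by (auto simp: S_def)
  have "open S"
    unfolding S_eq by (intro open_Compl closed_vimage closed_nonpos_Ints continuous_intros)
  \<comment> \<open>A plane with countably many points removed stays connected, as the identity
    theorem demands.\<close>
  have "- S = (\<lambda>n. of_int n / 5) ` {n. n \<le> 0}"
    by (auto simp: S_def image_iff field_simps elim!: nonpos_Ints_cases intro!: nonpos_Ints_of_int)
  hence "countable (- S)" by simp
  hence "connected (UNIV - (- S))"
    by (intro connected_open_diff_countable) auto
  hence "connected S" by (simp add: Diff_eq)
  have "F holomorphic_on S"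
    unfolding F_def by (intro holomorphic_appell_F1 \<open>open S\<close> holomorphic_intros) (auto simp: S_def)
  \<comment> \<open>The only possible poles are those of \<open>Gamma (5 * a)\<close>, and
    \<open>S\<close> excludes exactly these.\<close>
  moreover have "R holomorphic_on S"
    unfolding R_def by (intro holomorphic_intros) (auto simp: S_def)
  ultimately have "(\<lambda>a. F a - R a) holomorphic_on S"
    by (intro holomorphic_intros)
  moreover have "2 islimpt U"
  proof -
    have "complex_of_real (2 + e / 2) \<in> U \<and> complex_of_real (2 + e / 2) \<noteq> 2 \<and>
        dist (complex_of_real (2 + e / 2)) 2 < e" if "e > 0" for e
      using that by (auto simp: U_def dist_norm complex_eq_iff)
    thus ?thesis unfolding islimpt_approachable by blast
  qed
  moreover have "U \<subseteq> S" "2 \<in> S"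
    by (auto simp: U_def S_def complex_eq_iff elim!: nonpos_Ints_cases)
  moreover have "F a - R a = 0" if a: "a \<in> U" for a
  proof -
    obtain b where b: "a = of_real b" "b > 1" using a by (auto simp: U_def)
    \<comment> \<open>The bases 2, 3 and 5 are positive, so complex \<open>powr\<close> at real
      exponents agrees with the real one.\<close>
    have "R a = of_real (3 powr (8 * b) / (2 powr (2 * b - 1) * 5 powr (5 * b)) *
           (pi * Gamma (5 * b) * rGamma (b + 1 / 2) ^ 2 * rGamma (3 * b)))"
      by (simp add: R_def b flip: powr_of_real Gamma_complex_of_real rGamma_complex_of_real)
    thus ?thesis
      using appell_F1_special_value_real[OF b(2)] by (simp add: F_def b(1))
  qed
  moreover have "a \<in> S" using assms by (simp add: S_def)
  ultimately have "F a - R a = 0"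
    using analytic_continuation[of "\<lambda>a. F a - R a" S U 2 a] \<open>open S\<close> \<open>connected S\<close> by blast
  thus ?thesis by (simp add: F_def R_def)
qed

end
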